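(* For all integers $n\ge 2$ and $0\le m\le \binom n2-1$ there exists a matrix $\rho_{n,m}$ with rows indexed by $\mathcal X(n,m)$ and columns indexed by $\mathcal X(n,m+1)$ such that all entries are nonnegative, and (a) $\sum_{\boldsymbol y\in\mathcal X(n,m+1)}\rho_{n,m}(\boldsymbol x,\boldsymbol y)=1$ for every $\boldsymbol x\in\mathcal X(n,m)$; (b) $\frac{1}{s(n,m)}\sum_{\boldsymbol x\in\mathcal X(n,m)}\rho_{n,m}(\boldsymbol x,\boldsymbol y)=\frac{1}{s(n,m+1)}$ for every $\boldsymbol y\in\mathcal X(n,m+1)$; (c) $\rho_{n,m}(\boldsymbol x,\boldsymbol y)=0$ whenever $\boldsymbol y$ does not cover $\boldsymbol x$.
   Context: $\mathcal X(n,m)$ is the set of integer sequences $\boldsymbol x=x_1x_2\cdots x_n$ with $0\le x_i\le i-1$ for all $i\in[n]$ and $x_1+\cdots+x_n=m$ (these are exactly the inversion sequences of permutations of $[n]$ with $m$ inversions, where the inversion sequence of $\boldsymbol\sigma$ has $x_i=|\{j<i:\sigma(j)>\sigma(i)\}|$). $s(n,m)=|\mathcal X(n,m)|$, the number of permutations of $[n]$ with $m$ inversions. For $\boldsymbol x\in\mathcal X(n,m)$ and $\boldsymbol y\in\mathcal X(n,m+1)$, $\boldsymbol y$ covers $\boldsymbol x$ if there is an index $j$ with $y_j=x_j+1$ and $y_i=x_i$ for all $i\ne j$. *)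

theory Defs
  imports Complex_Main
begin

text \<open>
  A sequence \<open>x\<^sub>1 \<dots> x\<^sub>n\<close> is the list \<open>x\<close> with \<open>x ! i = x\<^sub>i\<^sub>+\<^sub>1\<close>, so the bound
  \<open>0 \<le> x\<^sub>i \<le> i - 1\<close> for \<open>1 \<le> i \<le> n\<close> reads \<open>x ! i \<le> i\<close> for \<open>i < n\<close>.
\<close>

definition inv_seqs :: "nat \<Rightarrow> nat \<Rightarrow> nat list set" where
  "inv_seqs n m = {x. length x = n \<and> (\<forall>i<n. x ! i \<le> i) \<and> sum_list x = m}"

definition s :: "nat \<Rightarrow> nat \<Rightarrow> nat" where
  "s n m = card (inv_seqs n m)"

definition covers :: "nat list \<Rightarrow> nat list \<Rightarrow> bool" (infix "covers" 50) where
  "y covers x \<longleftrightarrow> length y = length x \<and>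
     (\<exists>j<length x. y ! j = x ! j + 1 \<and> (\<forall>i<length x. i \<noteq> j \<longrightarrow> y ! i = x ! i))"

lemma finite_inv_seqs: "finite (inv_seqs n m)"
proof (rule finite_subset)
  show "inv_seqs n m \<subseteq> {x. set x \<subseteq> {..m} \<and> length x = n}"
    by (auto simp: inv_seqs_def intro: member_le_sum_list)
qed (rule finite_lists_length_eq, simp)

end

theory Submission
  imports Defs
begin

text \<open>
  The sequences of length \<open>n\<close>, ordered componentwise, form a product of chains, and the theorem is
  its normalized matching property in the form of a normalized flow. Induct on \<open>n\<close>, splitting by
  the last entry \<open>k\<close>: the mass of the block \<open>k\<close> can be moved inside that block by the flow for
  length \<open>n\<close>, or to the block \<open>k + 1\<close> by increasing the last entry. Both moves turn a uniform
  distribution on a block into a uniform one, so it only remains to transport the block masses along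
  the path \<open>0, 1, \<dots>, n\<close>. The transport is determined by the partial sums of the two block
  distributions, and it is nonnegative because the rank numbers are log-concave.
\<close>

section \<open>Log-concave sequences\<close>

text \<open>Quantifying over every \<open>d\<close> rules out internal zeros, which the condition on
  three neighbours alone would allow.\<close>

definition log_concave :: "(int \<Rightarrow> real) \<Rightarrow> bool" where
  "log_concave t \<longleftrightarrow> (\<forall>z. 0 \<le> t z) \<and>
     (\<forall>p q (d::nat). p \<le> q \<longrightarrow> t p * t (q + int d) \<le> t (p + int d) * t q)"

lemma log_concaveD:
  assumes "log_concave t" "p \<le> u" "p \<le> v" "u + v = p + q"
  shows "t p * t q \<le> t u * t v"
proof -
  have "t p * t (v + int (nat (u - p))) \<le> t (p + int (nat (u - p))) * t v"
    using assms unfolding log_concave_def by blast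
  moreover have "v + int (nat (u - p)) = q" "p + int (nat (u - p)) = u"
    using assms by auto
  ultimately show ?thesis by simp
qed

lemma log_concaveI:
  assumes nonneg: "\<And>z. 0 \<le> t z"
    and step: "\<And>p q. p \<le> q \<Longrightarrow> t p * t (q + 1) \<le> t (p + 1) * t q"
  shows "log_concave t"
proof -
  have "t p * t (q + int d) \<le> t (p + int d) * t q" if "p \<le> q" for p q d
    using that
  proof (induction d arbitrary: p q)
    case (Suc d)
    show ?case
    proof (cases "p = q")
      case False
      have "t p * t (q + int (Suc d)) \<le> t (p + 1) * t (q + int d)"
        using step[of p "q + int d"] Suc.prems by (simp add: algebra_simps)
      also have "\<dots> \<le> t (p + 1 + int d) * t q"
        using Suc.IH[of "p + 1" q] Suc.prems False by simp
      finally show ?thesis by (simp add: algebra_simps)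
    qed simp
  qed simp
  then show ?thesis using nonneg unfolding log_concave_def by blast
qed

text \<open>Sliding the window by one gains \<open>t (z + 1)\<close> and loses
  \<open>t (z - int n)\<close>. After cancelling \<open>?W p * ?W q\<close>, the gained and the lost
  terms are compared separately, summand by summand.\<close>

lemma log_concave_window_sum:
  assumes t: "log_concave t"
  shows "log_concave (\<lambda>z. \<Sum>k\<le>n. t (z - int k))" (is "log_concave ?W")
proof (rule log_concaveI)
  show "0 \<le> ?W z" for z
    using t by (auto simp: log_concave_def intro: sum_nonneg)
next
  fix p q :: int
  assume pq: "p \<le> q"
  have shift: "?W (z + 1) = ?W z + t (z + 1) - t (z - int n)" for z
    by (induction n) (auto simp: algebra_simps)
  have "t (q + 1) * ?W p \<le> t (p + 1) * ?W q"
    unfolding sum_distrib_left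
  proof (rule sum_mono)
    show "t (q + 1) * t (p - int i) \<le> t (p + 1) * t (q - int i)" for i
      using log_concaveD[OF t, of "p - int i" "p + 1" "q - int i" "q + 1"] pq
      by (simp add: mult.commute)
  qed
  moreover have "t (p - int n) * ?W q \<le> t (q - int n) * ?W p"
    unfolding sum_distrib_left
  proof (rule sum_mono)
    show "t (p - int n) * t (q - int i) \<le> t (q - int n) * t (p - int i)" if "i \<in> {..n}" for i
      using log_concaveD[OF t, of "p - int n" "q - int n" "p - int i" "q - int i"] pq that
      by simp
  qed
  ultimately show "?W p * ?W (q + 1) \<le> ?W (p + 1) * ?W q"
    unfolding shift by (simp add: algebra_simps)
qed

text \<open>Block \<open>k\<close> has mass \<open>t (m - int k) / W m\<close> before and
  \<open>t (m + 1 - int k) / W (m + 1)\<close> after the transport. It keeps \<open>f k\<close> and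
  passes \<open>g k\<close> to block \<open>k + 1\<close>; \<open>g n = 0\<close> because the path
  ends at \<open>n\<close>.\<close>

lemma path_transport:
  fixes t :: "int \<Rightarrow> real" and n :: nat
  defines "W \<equiv> \<lambda>z. \<Sum>k\<le>n. t (z - int k)"
  assumes t: "log_concave t" and pos: "0 < W m" "0 < W (m + 1)"
  obtains f g :: "nat \<Rightarrow> real" where
    "\<And>k. k \<le> n \<Longrightarrow> 0 \<le> f k" "\<And>k. k \<le> n \<Longrightarrow> 0 \<le> g k" "g n = 0"
    "\<And>k. f k + g k = t (m - int k) / W m"
    "f 0 = t (m + 1) / W (m + 1)"
    "\<And>k. f (Suc k) + g k = t (m - int k) / W (m + 1)"
proof -
  define A where "A k = (\<Sum>i<k. t (m - int i))" for k
  define B where "B k = (\<Sum>i<k. t (m + 1 - int i))" for k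
  have nonneg: "0 \<le> t z" for z using t by (simp add: log_concave_def)
  have B_Suc: "B (Suc k) = t (m + 1) + A k" for k
    unfolding A_def B_def by (subst sum.lessThan_Suc_shift) (simp add: algebra_simps)
  have A_Suc: "A (Suc k) = A k + t (m - int k)" for k
    by (simp add: A_def)
  have WA: "W m = A (Suc n)" and WB: "W (m + 1) = B (Suc n)"
    by (simp_all add: W_def A_def B_def lessThan_Suc_atMost)
  have AB_pos: "0 < A (Suc n)" "0 < B (Suc n)" using pos WA WB by simp_all
  have A_nonneg: "0 \<le> A k" for k by (simp add: A_def sum_nonneg nonneg)
  have A_mono: "A k \<le> A n" if "k \<le> n" for k
    unfolding A_def using that nonneg by (intro sum_mono2) auto
  \<comment> \<open>\<open>B\<close> is \<open>A\<close> delayed by one index with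
    \<open>t (m + 1)\<close> in front, so the cross-multiplied difference is exactly the sum of
    nonnegative products below.\<close>
  have AB: "A k / W m \<le> B (Suc k) / W (m + 1)" if "k \<le> n" for k
  proof -
    have "0 \<le> t (m + 1) * (A n - A k) + t (m + 1) * t (m - int n) + A k * t (m - int n)"
      using A_mono[OF that] A_nonneg[of k] by (simp add: nonneg)
    then have "A k * B (Suc n) \<le> B (Suc k) * A (Suc n)"
      by (simp add: B_Suc A_Suc algebra_simps)
    then show ?thesis
      unfolding WA WB using AB_pos by (simp add: field_simps)
  qed
  \<comment> \<open>Log-concavity enters here: once \<open>A k * B k\<close> cancels, each head
    index \<open>i < k\<close> is paired with a tail index \<open>j \<ge> k\<close>.\<close>
  have BA: "B k / W (m + 1) \<le> A k / W m" if "k \<le> Suc n" for k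
  proof -
    have split: "A (Suc n) = A k + (\<Sum>j\<in>{k..<Suc n}. t (m - int j))"
      "B (Suc n) = B k + (\<Sum>j\<in>{k..<Suc n}. t (m + 1 - int j))"
      using that unfolding A_def B_def atLeast0LessThan[symmetric]
      by (simp_all only: sum.atLeastLessThan_concat le0)
    have "B k * (\<Sum>j\<in>{k..<Suc n}. t (m - int j)) \<le> A k * (\<Sum>j\<in>{k..<Suc n}. t (m + 1 - int j))"
      unfolding A_def B_def sum_product
    proof (intro sum_mono)
      fix i j
      assume "i \<in> {..<k}" "j \<in> {k..<Suc n}"
      then show "t (m + 1 - int i) * t (m - int j) \<le> t (m - int i) * t (m + 1 - int j)"
        using log_concaveD[OF t, of "m - int j" "m - int i" "m + 1 - int j" "m + 1 - int i"]
        by (simp add: mult.commute)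
    qed
    then have "B k * A (Suc n) \<le> A k * B (Suc n)"
      unfolding split distrib_left by (simp only: mult.commute add_left_mono)
    then show ?thesis
      unfolding WA WB using AB_pos by (simp add: field_simps)
  qed
  \<comment> \<open>Conservation of mass forces these values: \<open>g k\<close> is what blocks
    \<open>0\<close> to \<open>k\<close> hold before, minus what they hold after.\<close>
  define f where "f k = B (Suc k) / W (m + 1) - A k / W m" for k
  define g where "g k = A (Suc k) / W m - B (Suc k) / W (m + 1)" for k
  show thesis
  proof (rule that)
    show "0 \<le> f k" if "k \<le> n" for k using AB[OF that] by (simp add: f_def)
    show "0 \<le> g k" if "k \<le> n" for k using BA[of "Suc k"] that by (simp add: g_def)
    show "g n = 0" using pos by (simp add: g_def WA WB)
    show "f k + g k = t (m - int k) / W m" for k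
      by (simp add: f_def g_def A_Suc add_divide_distrib)
    show "f 0 = t (m + 1) / W (m + 1)"
      by (simp add: f_def B_def A_def)
    show "f (Suc k) + g k = t (m - int k) / W (m + 1)" for k
      by (simp add: f_def g_def B_Suc A_Suc add_divide_distrib)
  qed
qed

section \<open>Rank numbers\<close>

text \<open>The sum is an integer here, so that \<open>m - k\<close> is not truncated and the levels below \<open>0\<close> are empty.\<close>

definition level :: "nat \<Rightarrow> int \<Rightarrow> nat list set" where
  "level n z = {x. length x = n \<and> (\<forall>i<n. x ! i \<le> i) \<and> int (sum_list x) = z}"

definition rank_num :: "nat \<Rightarrow> int \<Rightarrow> real" where
  "rank_num n z = real (card (level n z))"

lemma level_of_nat: "level n (int m) = inv_seqs n m"
  by (simp add: level_def inv_seqs_def)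

lemma finite_level: "finite (level n z)"
proof (rule finite_subset)
  show "level n z \<subseteq> inv_seqs n (nat z)" by (auto simp: level_def inv_seqs_def)
qed (rule finite_inv_seqs)

lemma level_0: "level 0 z = (if z = 0 then {[]} else {})"
  by (auto simp: level_def)

lemma append_in_level_iff:
  "x @ [k] \<in> level (Suc n) z \<longleftrightarrow> k \<le> n \<and> x \<in> level n (z - int k)"
  by (fastforce simp: level_def nth_append less_Suc_eq)

lemma level_Suc: "level (Suc n) z = (\<Union>k\<le>n. (\<lambda>x. x @ [k]) ` level n (z - int k))"
proof (rule set_eqI)
  fix v
  show "v \<in> level (Suc n) z \<longleftrightarrow> v \<in> (\<Union>k\<le>n. (\<lambda>x. x @ [k]) ` level n (z - int k))"
  proof (cases v rule: rev_cases)
    case Nil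
    then show ?thesis by (auto simp: level_def)
  next
    case (snoc x k)
    then show ?thesis by (auto simp: append_in_level_iff)
  qed
qed

lemma level_SucE:
  assumes "v \<in> level (Suc n) z"
  obtains x k where "v = x @ [k]" "k \<le> n" "x \<in> level n (z - int k)"
  using assms unfolding level_Suc by blast

lemma sum_level_Suc:
  "(\<Sum>v\<in>level (Suc n) z. h v) = (\<Sum>k\<le>n. \<Sum>x\<in>level n (z - int k). h (x @ [k]))"
  unfolding level_Suc
  by (subst sum.UNION_disjoint) (auto simp: finite_level sum.reindex inj_on_def)

lemma rank_num_Suc: "rank_num (Suc n) z = (\<Sum>k\<le>n. rank_num n (z - int k))"
  using sum_level_Suc[where h = "\<lambda>_. 1::real"] by (simp add: rank_num_def)

text \<open>Appending a last entry makes the rank numbers a window sum of the previous ones,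
  starting from the indicator of \<open>0\<close>.\<close>

lemma log_concave_rank_num: "log_concave (rank_num n)"
proof (induction n)
  case 0
  show ?case by (rule log_concaveI) (auto simp: rank_num_def level_0)
next
  case (Suc n)
  then show ?case
    using log_concave_window_sum[of "rank_num n" n] by (simp add: rank_num_Suc[abs_def])
qed

lemma rank_num_pos_iff: "0 < rank_num n z \<longleftrightarrow> level n z \<noteq> {}"
  by (simp add: rank_num_def card_gt_0_iff finite_level)

lemma level_nonempty:
  assumes "0 \<le> z" "z \<le> int (n choose 2)"
  shows "level n z \<noteq> {}"
  using assms
proof (induction n arbitrary: z)
  case 0
  then show ?case by (simp add: level_0 numeral_2_eq_2)
next
  case (Suc n)
  \<comment> \<open>Greedy choice: the last entry is as large as possible, leaving \<open>0\<close>
    or \<open>z - int n\<close>.\<close>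
  define k where "k = min (nat z) n"
  have "Suc n choose 2 = n + (n choose 2)"
    by (simp add: numeral_2_eq_2)
  then have "0 \<le> z - int k" "z - int k \<le> int (n choose 2)"
    using Suc.prems by (auto simp: k_def)
  then obtain x where "x \<in> level n (z - int k)"
    using Suc.IH by blast
  then have "x @ [k] \<in> level (Suc n) z"
    by (simp add: append_in_level_iff k_def)
  then show ?case by blast
qed

section \<open>Normalized flows\<close>

lemma covers_append_same: "y covers x \<Longrightarrow> (y @ [k]) covers (x @ [k])"
  unfolding covers_def by (force simp: nth_append less_Suc_eq)

lemma covers_append_Suc: "(x @ [Suc k]) covers (x @ [k])"
  unfolding covers_def by (force simp: nth_append)

text \<open>The total mass is \<open>1\<close>, uniform on either level: this is \<open>\<rho>\<close> divided by \<open>s n m\<close>.\<close>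

definition normalized_flow :: "nat \<Rightarrow> int \<Rightarrow> (nat list \<Rightarrow> nat list \<Rightarrow> real) \<Rightarrow> bool" where
  "normalized_flow n z \<phi> \<longleftrightarrow>
     (\<forall>x\<in>level n z. \<forall>y\<in>level n (z + 1). 0 \<le> \<phi> x y \<and> (\<not> y covers x \<longrightarrow> \<phi> x y = 0)) \<and>
     (\<forall>x\<in>level n z. (\<Sum>y\<in>level n (z + 1). \<phi> x y) = 1 / rank_num n z) \<and>
     (\<forall>y\<in>level n (z + 1). (\<Sum>x\<in>level n z. \<phi> x y) = 1 / rank_num n (z + 1))"

lemma normalized_flow_exists:
  assumes "level n z \<noteq> {}" "level n (z + 1) \<noteq> {}"
  shows "\<exists>\<phi>. normalized_flow n z \<phi>"
  using assms
proof (induction n arbitrary: z)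
  case 0
  then show ?case by (simp add: level_0 split: if_splits)
next
  case (Suc n)
  let ?r = "rank_num n" and ?R = "rank_num (Suc n)"
  have "0 < ?R z" "0 < ?R (z + 1)"
    using Suc.prems by (simp_all add: rank_num_pos_iff)
  then obtain f g where fg:
    "\<And>k. k \<le> n \<Longrightarrow> 0 \<le> f k" "\<And>k. k \<le> n \<Longrightarrow> 0 \<le> g k" "g n = 0"
    and out: "\<And>k. f k + g k = ?r (z - int k) / ?R z"
    and in_0: "f 0 = ?r (z + 1) / ?R (z + 1)"
    and in_Suc: "\<And>k. f (Suc k) + g k = ?r (z - int k) / ?R (z + 1)"
    using path_transport[OF log_concave_rank_num[of n], where n = n and m = z] unfolding rank_num_Suc by blast
  have r_nonneg: "0 \<le> ?r u" for u by (simp add: rank_num_def)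
  \<comment> \<open>\<open>f k\<close> is part of both the old and the new mass of block
    \<open>k\<close>, so if it is positive, neither level of that block is empty.\<close>
  have ex_flow: "\<exists>\<phi>. normalized_flow n (z - int k) \<phi>" if "k \<le> n" "f k \<noteq> 0" for k
  proof (rule Suc.IH)
    have "0 < f k" using fg(1)[OF that(1)] that(2) by simp
    then have "0 < ?r (z - int k) / ?R z" using out[of k] fg(2)[OF that(1)] by simp
    then show "level n (z - int k) \<noteq> {}" using r_nonneg[of "z - int k"]
      by (auto simp: zero_less_divide_iff rank_num_pos_iff)
    have "0 < ?r (z - int k + 1) / ?R (z + 1)"
    proof (cases k)
      case 0
      then show ?thesis using in_0 \<open>0 < f k\<close> by simp
    next
      case (Suc j)
      then show ?thesis using in_Suc[of j] fg(2)[of j] \<open>0 < f k\<close> that(1) by simp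
    qed
    then show "level n (z - int k + 1) \<noteq> {}" using r_nonneg[of "z - int k + 1"]
      by (auto simp: zero_less_divide_iff rank_num_pos_iff)
  qed
  then obtain \<phi> where \<phi>: "\<And>k. k \<le> n \<Longrightarrow> f k \<noteq> 0 \<Longrightarrow> normalized_flow n (z - int k) (\<phi> k)"
    by metis
  \<comment> \<open>The first summand scales the unit flow inside a block to mass
    \<open>f k\<close>; the second spreads \<open>g k\<close> evenly over the block while raising
    the last entry.\<close>
  define \<psi> where "\<psi> u v =
      (if last v = last u then f (last u) * \<phi> (last u) (butlast u) (butlast v) else 0) +
      (if last v = Suc (last u) \<and> butlast v = butlast u
       then g (last u) / ?r (z - int (last u)) else 0)" for u v
  have \<psi>_append: "\<psi> (x @ [k]) (y @ [l]) =
      (if l = k then f k * \<phi> k x y else 0) +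
      (if l = Suc k then (if y = x then g k / ?r (z - int k) else 0) else 0)" for x y k l
    by (simp add: \<psi>_def)
  have "normalized_flow (Suc n) z \<psi>"
    unfolding normalized_flow_def
  proof (intro conjI ballI)
    fix u v
    assume "u \<in> level (Suc n) z" and "v \<in> level (Suc n) (z + 1)"
    then obtain x k y l where u: "u = x @ [k]" "k \<le> n" "x \<in> level n (z - int k)"
      and v: "v = y @ [l]" "l \<le> n" "y \<in> level n (z + 1 - int l)"
      by (meson level_SucE)
    \<comment> \<open>Nothing is known about \<open>\<phi> k\<close> when \<open>f k = 0\<close>,
      but then the product vanishes.\<close>
    have \<phi>': "0 \<le> f k * \<phi> k x y \<and> (\<not> y covers x \<longrightarrow> f k * \<phi> k x y = 0)" if "l = k"
    proof (cases "f k = 0")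
      case False
      have "y \<in> level n (z - int k + 1)" using v(3) that by (simp add: algebra_simps)
      then show ?thesis
        using \<phi>[OF u(2) False] u(3) fg(1)[OF u(2)] by (simp add: normalized_flow_def)
    qed simp
    show "0 \<le> \<psi> u v"
      using \<phi>' fg(2)[OF u(2)] r_nonneg[of "z - int k"] by (simp add: u(1) v(1) \<psi>_append)
    show "\<not> v covers u \<longrightarrow> \<psi> u v = 0"
      using \<phi>' covers_append_same[of y x k] covers_append_Suc[of x k]
      by (auto simp: u(1) v(1) \<psi>_append)
  next
    fix u
    assume "u \<in> level (Suc n) z"
    then obtain x k where u: "u = x @ [k]" "k \<le> n" "x \<in> level n (z - int k)"
      by (rule level_SucE)
    have r_pos: "0 < ?r (z - int k)" using u(3) by (auto simp: rank_num_pos_iff)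
    have stay: "(\<Sum>y\<in>level n (z + 1 - int k). f k * \<phi> k x y) = f k / ?r (z - int k)"
    proof (cases "f k = 0")
      case False
      have "(\<Sum>y\<in>level n (z - int k + 1). \<phi> k x y) = 1 / ?r (z - int k)"
        using \<phi>[OF u(2) False] u(3) by (simp add: normalized_flow_def)
      moreover have "z - int k + 1 = z + 1 - int k" by simp
      ultimately show ?thesis by (simp flip: sum_distrib_left)
    qed simp
    have "(\<Sum>v\<in>level (Suc n) (z + 1). \<psi> u v) =
        (\<Sum>l\<le>n. (if l = k then f k / ?r (z - int k) else 0) +
                (if l = Suc k then g k / ?r (z - int k) else 0))"
      unfolding sum_level_Suc u(1) \<psi>_append
    proof (rule sum.cong)
      fix l
      show "(\<Sum>y\<in>level n (z + 1 - int l).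
            (if l = k then f k * \<phi> k x y else 0) +
            (if l = Suc k then (if y = x then g k / ?r (z - int k) else 0) else 0)) =
          (if l = k then f k / ?r (z - int k) else 0) +
          (if l = Suc k then g k / ?r (z - int k) else 0)"
        using stay u(3) by (auto simp: finite_level)
    qed simp
    also have "\<dots> = f k / ?r (z - int k) + g k / ?r (z - int k)"
      \<comment> \<open>For \<open>k = n\<close> the index \<open>Suc k\<close> falls outside the
        sum, which matches \<open>g n = 0\<close>.\<close>
      using u(2) fg(3) by (cases "k = n") (auto simp: sum.distrib)
    also have "\<dots> = 1 / ?R z"
      using out[of k] r_pos by (simp flip: add_divide_distrib)
    finally show "(\<Sum>v\<in>level (Suc n) (z + 1). \<psi> u v) = 1 / ?R z" .
  next
    fix v
    assume "v \<in> level (Suc n) (z + 1)"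
    then obtain y l where v: "v = y @ [l]" "l \<le> n" "y \<in> level n (z + 1 - int l)"
      by (rule level_SucE)
    \<comment> \<open>For \<open>l = Suc k\<close> this is also \<open>?r (z - int k)\<close>, so
      lifted mass arrives with the right denominator.\<close>
    let ?b = "?r (z + 1 - int l)"
    have r_pos: "0 < ?b" using v(3) by (auto simp: rank_num_pos_iff)
    have stay: "(\<Sum>x\<in>level n (z - int l). f l * \<phi> l x y) = f l / ?b"
    proof (cases "f l = 0")
      case False
      have eq: "z - int l + 1 = z + 1 - int l" by simp
      have "(\<Sum>x\<in>level n (z - int l). \<phi> l x y) = 1 / ?b"
        using \<phi>[OF v(2) False] v(3) by (simp add: normalized_flow_def eq)
      then show ?thesis by (simp flip: sum_distrib_left)
    qed simp
    have "(\<Sum>u\<in>level (Suc n) z. \<psi> u v) =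
        (\<Sum>k\<le>n. (if k = l then f l / ?b else 0) + (if l = Suc k then g k / ?b else 0))"
      unfolding sum_level_Suc v(1) \<psi>_append
    proof (rule sum.cong)
      fix k
      show "(\<Sum>x\<in>level n (z - int k).
            (if l = k then f k * \<phi> k x y else 0) +
            (if l = Suc k then (if y = x then g k / ?r (z - int k) else 0) else 0)) =
          (if k = l then f l / ?b else 0) + (if l = Suc k then g k / ?b else 0)"
        using stay v(3) by (auto simp: finite_level)
    qed simp
    also have "\<dots> = 1 / ?R (z + 1)"
    \<comment> \<open>Block \<open>0\<close> receives no lifted mass; block \<open>Suc j\<close>
      receives it from block \<open>j\<close> alone.\<close>
    proof (cases l)
      case 0
      then show ?thesis using in_0 r_pos by (simp add: sum.distrib)
    next
      case (Suc j)
      have "(\<Sum>k\<le>n. (if k = l then f l / ?b else 0) + (if l = Suc k then g k / ?b else 0)) =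
          f l / ?b + g j / ?b"
        using v(2) Suc by (simp add: sum.distrib)
      also have "\<dots> = 1 / ?R (z + 1)"
        using in_Suc[of j] r_pos Suc by (simp flip: add_divide_distrib)
      finally show ?thesis .
    qed
    finally show "(\<Sum>u\<in>level (Suc n) z. \<psi> u v) = 1 / ?R (z + 1)" .
  qed
  then show ?case by blast
qed

theorem theorem2p3:
  fixes n m :: nat
  assumes "n \<ge> 2" and "m \<le> (n choose 2) - 1"
  shows "\<exists>\<rho> :: nat list \<Rightarrow> nat list \<Rightarrow> real.
    (\<forall>x\<in>inv_seqs n m. \<forall>y\<in>inv_seqs n (m + 1). \<rho> x y \<ge> 0) \<and>
    (\<forall>x\<in>inv_seqs n m. (\<Sum>y\<in>inv_seqs n (m + 1). \<rho> x y) = 1) \<and>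
    (\<forall>y\<in>inv_seqs n (m + 1).
       1 / real (s n m) * (\<Sum>x\<in>inv_seqs n m. \<rho> x y) = 1 / real (s n (m + 1))) \<and>
    (\<forall>x\<in>inv_seqs n m. \<forall>y\<in>inv_seqs n (m + 1). \<not> y covers x \<longrightarrow> \<rho> x y = 0)"
proof -
  \<comment> \<open>Positivity ensures that the natural subtraction in the bound on \<open>m\<close>
    does not truncate, so level \<open>m + 1\<close> is nonempty too.\<close>
  have "0 < n choose 2" using assms(1) by (simp add: zero_less_binomial_iff)
  then have m: "m + 1 \<le> n choose 2" using assms(2) by linarith
  have succ: "int m + 1 = int (m + 1)" by simp
  have "level n (int m) \<noteq> {}" "level n (int m + 1) \<noteq> {}"
    using m by (simp_all add: level_nonempty)
  then obtain \<phi> where \<phi>: "normalized_flow n (int m) \<phi>"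
    using normalized_flow_exists by blast
  have rank: "rank_num n (int k) = real (s n k)" for k
    by (simp add: rank_num_def s_def level_of_nat)
  have "0 < s n m"
    using \<open>level n (int m) \<noteq> {}\<close> by (simp add: rank flip: rank_num_pos_iff)
  then show ?thesis
    using \<phi> unfolding normalized_flow_def succ level_of_nat rank
    by (intro exI[of _ "\<lambda>x y. real (s n m) * \<phi> x y"]) (simp flip: sum_distrib_left)
qed

end
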